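(* An idempotent semiring $S$ belongs to $\mathbf{V}_{\mathcal{D}}$ if and only if $S$ is isomorphic to a spined product of an idempotent semiring $S_1\in\mathbf{V}_{\mathcal{L}}$ and an idempotent semiring $S_2\in\mathbf{V}_{\mathcal{R}}$ with respect to some distributive lattice $D$.
   Context: An idempotent semiring is an algebra $(S,+,\cdot)$ with $(S,+)$, $(S,\cdot)$ bands and both distributive laws; addition not assumed commutative. $\mathbf{V}_{\mathcal{D}}$, $\mathbf{V}_{\mathcal{L}}$, $\mathbf{V}_{\mathcal{R}}$ denote the varieties of idempotent semirings on which the Green's relation $\mathcal{D}^{\bullet}$ (resp. $\mathcal{L}^{\bullet}$, $\mathcal{R}^{\bullet}$) is the least distributive lattice congruence; equivalently, those satisfying $x\approx xyx+x+xyx$ (resp. $x\approx xy+x+xy$, $x\approx yx+x+yx$). Here $a\,\mathcal{D}^{\bullet}\,b$ iff $aba=a,\ bab=b$; $a\,\mathcal{L}^{\bullet}\,b$ iff $ab=a,\ ba=b$; $a\,\mathcal{R}^{\bullet}\,b$ iff $ab=b,\ ba=a$. Given semirings $S_1,S_2$, a distributive lattice $D$ and surjective homomorphisms $\phi_1:S_1\to D$, $\phi_2:S_2\to D$, the spined product of $S_1$ and $S_2$ with respect to $D$ is the subsemiring $\{(s_1,s_2)\in S_1\times S_2:\phi_1(s_1)=\phi_2(s_2)\}$ of $S_1\times S_2$. *)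

theory Defs
  imports Main
begin

definition idem_semiring :: "'a set \<Rightarrow> ('a \<Rightarrow> 'a \<Rightarrow> 'a) \<Rightarrow> ('a \<Rightarrow> 'a \<Rightarrow> 'a) \<Rightarrow> bool" where
  "idem_semiring S add mul \<longleftrightarrow>
     (\<forall>x\<in>S. \<forall>y\<in>S. add x y \<in> S \<and> mul x y \<in> S) \<and>
     (\<forall>x\<in>S. \<forall>y\<in>S. \<forall>z\<in>S. add (add x y) z = add x (add y z)) \<and>
     (\<forall>x\<in>S. \<forall>y\<in>S. \<forall>z\<in>S. mul (mul x y) z = mul x (mul y z)) \<and>
     (\<forall>x\<in>S. add x x = x \<and> mul x x = x) \<and>
     (\<forall>x\<in>S. \<forall>y\<in>S. \<forall>z\<in>S. mul x (add y z) = add (mul x y) (mul x z)) \<and>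
     (\<forall>x\<in>S. \<forall>y\<in>S. \<forall>z\<in>S. mul (add x y) z = add (mul x z) (mul y z))"

definition distrib_lattice_alg :: "'a set \<Rightarrow> ('a \<Rightarrow> 'a \<Rightarrow> 'a) \<Rightarrow> ('a \<Rightarrow> 'a \<Rightarrow> 'a) \<Rightarrow> bool" where
  "distrib_lattice_alg D join meet \<longleftrightarrow>
     (\<forall>x\<in>D. \<forall>y\<in>D. join x y \<in> D \<and> meet x y \<in> D) \<and>
     (\<forall>x\<in>D. \<forall>y\<in>D. \<forall>z\<in>D. join (join x y) z = join x (join y z)) \<and>
     (\<forall>x\<in>D. \<forall>y\<in>D. \<forall>z\<in>D. meet (meet x y) z = meet x (meet y z)) \<and>
     (\<forall>x\<in>D. \<forall>y\<in>D. join x y = join y x \<and> meet x y = meet y x) \<and>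
     (\<forall>x\<in>D. \<forall>y\<in>D. join x (meet x y) = x \<and> meet x (join x y) = x) \<and>
     (\<forall>x\<in>D. \<forall>y\<in>D. \<forall>z\<in>D. meet x (join y z) = join (meet x y) (meet x z))"

definition is_hom :: "'a set \<Rightarrow> ('a \<Rightarrow> 'a \<Rightarrow> 'a) \<Rightarrow> ('a \<Rightarrow> 'a \<Rightarrow> 'a) \<Rightarrow>
                      'b set \<Rightarrow> ('b \<Rightarrow> 'b \<Rightarrow> 'b) \<Rightarrow> ('b \<Rightarrow> 'b \<Rightarrow> 'b) \<Rightarrow> ('a \<Rightarrow> 'b) \<Rightarrow> bool" where
  "is_hom A addA mulA B addB mulB f \<longleftrightarrow>
     (\<forall>x\<in>A. f x \<in> B) \<and>
     (\<forall>x\<in>A. \<forall>y\<in>A. f (addA x y) = addB (f x) (f y) \<and> f (mulA x y) = mulB (f x) (f y))"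

definition is_iso :: "'a set \<Rightarrow> ('a \<Rightarrow> 'a \<Rightarrow> 'a) \<Rightarrow> ('a \<Rightarrow> 'a \<Rightarrow> 'a) \<Rightarrow>
                      'b set \<Rightarrow> ('b \<Rightarrow> 'b \<Rightarrow> 'b) \<Rightarrow> ('b \<Rightarrow> 'b \<Rightarrow> 'b) \<Rightarrow> ('a \<Rightarrow> 'b) \<Rightarrow> bool" where
  "is_iso A addA mulA B addB mulB f \<longleftrightarrow> is_hom A addA mulA B addB mulB f \<and> bij_betw f A B"

definition isomorphic :: "'a set \<Rightarrow> ('a \<Rightarrow> 'a \<Rightarrow> 'a) \<Rightarrow> ('a \<Rightarrow> 'a \<Rightarrow> 'a) \<Rightarrow>
                      'b set \<Rightarrow> ('b \<Rightarrow> 'b \<Rightarrow> 'b) \<Rightarrow> ('b \<Rightarrow> 'b \<Rightarrow> 'b) \<Rightarrow> bool" where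
  "isomorphic A addA mulA B addB mulB \<longleftrightarrow> (\<exists>f. is_iso A addA mulA B addB mulB f)"

definition in_VD :: "'a set \<Rightarrow> ('a \<Rightarrow> 'a \<Rightarrow> 'a) \<Rightarrow> ('a \<Rightarrow> 'a \<Rightarrow> 'a) \<Rightarrow> bool" where
  "in_VD S add mul \<longleftrightarrow> idem_semiring S add mul \<and>
     (\<forall>x\<in>S. \<forall>y\<in>S. x = add (add (mul (mul x y) x) x) (mul (mul x y) x))"

definition in_VL :: "'a set \<Rightarrow> ('a \<Rightarrow> 'a \<Rightarrow> 'a) \<Rightarrow> ('a \<Rightarrow> 'a \<Rightarrow> 'a) \<Rightarrow> bool" where
  "in_VL S add mul \<longleftrightarrow> idem_semiring S add mul \<and>
     (\<forall>x\<in>S. \<forall>y\<in>S. x = add (add (mul x y) x) (mul x y))"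

definition in_VR :: "'a set \<Rightarrow> ('a \<Rightarrow> 'a \<Rightarrow> 'a) \<Rightarrow> ('a \<Rightarrow> 'a \<Rightarrow> 'a) \<Rightarrow> bool" where
  "in_VR S add mul \<longleftrightarrow> idem_semiring S add mul \<and>
     (\<forall>x\<in>S. \<forall>y\<in>S. x = add (add (mul y x) x) (mul y x))"

definition spined_carrier :: "'b set \<Rightarrow> 'c set \<Rightarrow> ('b \<Rightarrow> 'd) \<Rightarrow> ('c \<Rightarrow> 'd) \<Rightarrow> ('b \<times> 'c) set" where
  "spined_carrier S1 S2 phi1 phi2 = {(s1, s2). s1 \<in> S1 \<and> s2 \<in> S2 \<and> phi1 s1 = phi2 s2}"

definition prod_op :: "('b \<Rightarrow> 'b \<Rightarrow> 'b) \<Rightarrow> ('c \<Rightarrow> 'c \<Rightarrow> 'c) \<Rightarrow> ('b \<times> 'c) \<Rightarrow> ('b \<times> 'c) \<Rightarrow> ('b \<times> 'c)" where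
  "prod_op f g p q = (f (fst p) (fst q), g (snd p) (snd q))"

definition iso_spined_LR ::
  "'a set \<Rightarrow> ('a \<Rightarrow> 'a \<Rightarrow> 'a) \<Rightarrow> ('a \<Rightarrow> 'a \<Rightarrow> 'a) \<Rightarrow>
   'b set \<Rightarrow> ('b \<Rightarrow> 'b \<Rightarrow> 'b) \<Rightarrow> ('b \<Rightarrow> 'b \<Rightarrow> 'b) \<Rightarrow>
   'c set \<Rightarrow> ('c \<Rightarrow> 'c \<Rightarrow> 'c) \<Rightarrow> ('c \<Rightarrow> 'c \<Rightarrow> 'c) \<Rightarrow>
   'd set \<Rightarrow> ('d \<Rightarrow> 'd \<Rightarrow> 'd) \<Rightarrow> ('d \<Rightarrow> 'd \<Rightarrow> 'd) \<Rightarrow>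
   ('b \<Rightarrow> 'd) \<Rightarrow> ('c \<Rightarrow> 'd) \<Rightarrow> bool" where
  "iso_spined_LR S add mul S1 add1 mul1 S2 add2 mul2 D join meet phi1 phi2 \<longleftrightarrow>
     in_VL S1 add1 mul1 \<and> in_VR S2 add2 mul2 \<and> distrib_lattice_alg D join meet \<and>
     is_hom S1 add1 mul1 D join meet phi1 \<and> phi1 ` S1 = D \<and>
     is_hom S2 add2 mul2 D join meet phi2 \<and> phi2 ` S2 = D \<and>
     isomorphic S add mul (spined_carrier S1 S2 phi1 phi2) (prod_op add1 add2) (prod_op mul1 mul2)"

end

theory Submission
  imports Defs
begin

text \<open>
  The identity of \<open>in_VD\<close> says that \<open>x y x\<close> is absorbed by \<open>x\<close> additively on either side. This makes
  the Green's relations R, L and D of the multiplicative band congruences of the whole semiring. The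
  spined product is then formed from S/R and S/L over the distributive lattice S/D: the map from S to
  it is injective because R and L meet in the equality, and it is onto because \<open>x D y\<close> gives
  \<open>x R x y\<close> and \<open>x y L y\<close>.
\<close>

section \<open>Green's relations and operations on classes\<close>

definition green_R :: "'a set \<Rightarrow> ('a \<Rightarrow> 'a \<Rightarrow> 'a) \<Rightarrow> ('a \<times> 'a) set" where
  "green_R S mul = {(a, b). a \<in> S \<and> b \<in> S \<and> mul a b = b \<and> mul b a = a}"

definition green_L :: "'a set \<Rightarrow> ('a \<Rightarrow> 'a \<Rightarrow> 'a) \<Rightarrow> ('a \<times> 'a) set" where
  "green_L S mul = {(a, b). a \<in> S \<and> b \<in> S \<and> mul a b = a \<and> mul b a = b}"

definition green_D :: "'a set \<Rightarrow> ('a \<Rightarrow> 'a \<Rightarrow> 'a) \<Rightarrow> ('a \<times> 'a) set" where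
  "green_D S mul =
     {(a, b). a \<in> S \<and> b \<in> S \<and> mul (mul a b) a = a \<and> mul (mul b a) b = b}"

text \<open>Reversing the multiplication exchanges L and R, so facts proved for R can be carried
  over to L.\<close>

lemma green_L_eq_green_R_opposite: "green_L S mul = green_R S (\<lambda>x y. mul y x)"
  by (auto simp: green_L_def green_R_def)

text \<open>The union runs over all pairs of representatives, so none has to be chosen; for a
  congruence every member of the union is the same class.\<close>

definition quotient_op :: "('a \<times> 'a) set \<Rightarrow> ('a \<Rightarrow> 'a \<Rightarrow> 'a) \<Rightarrow> 'a set \<Rightarrow> 'a set \<Rightarrow> 'a set" where
  "quotient_op r f X Y = (\<Union>x\<in>X. \<Union>y\<in>Y. r `` {f x y})"

lemma quotient_op_class:
  assumes "equiv S r" "congruent2 r r (\<lambda>x y. r `` {f x y})" "x \<in> S" "y \<in> S"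
  shows "quotient_op r f (r `` {x}) (r `` {y}) = r `` {f x y}"
  unfolding quotient_op_def
  using UN_equiv_class2[OF assms(1,1,2,3,4)] by simp

text \<open>The two arguments are changed one at a time, and transitivity joins the two
  steps.\<close>

lemma congruent2_classI:
  assumes "equiv S r"
    and "\<And>a b c. (a, b) \<in> r \<Longrightarrow> c \<in> S \<Longrightarrow> (f a c, f b c) \<in> r"
    and "\<And>a b c. (a, b) \<in> r \<Longrightarrow> c \<in> S \<Longrightarrow> (f c a, f c b) \<in> r"
  shows "congruent2 r r (\<lambda>x y. r `` {f x y})"
proof (rule congruent2I')
  fix y1 z1 y2 z2
  assume r: "(y1, z1) \<in> r" "(y2, z2) \<in> r"
  then have "y2 \<in> S" "z1 \<in> S"
    using assms(1) by (auto simp: equiv_def refl_on_def)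
  with r assms(2,3) have "(f y1 y2, f z1 y2) \<in> r" "(f z1 y2, f z1 z2) \<in> r"
    by auto
  then have "(f y1 y2, f z1 z2) \<in> r"
    using assms(1) unfolding equiv_def trans_def by blast
  then show "r `` {f y1 y2} = r `` {f z1 z2}"
    using assms(1) equiv_class_eq by metis
qed

lemma idem_semiring_hom_image:
  assumes "idem_semiring S add mul" "is_hom S add mul T add' mul' f" "f ` S = T"
  shows "idem_semiring T add' mul'"
proof -
  have add: "add' (f x) (f y) = f (add x y)" if "x \<in> S" "y \<in> S" for x y
    using assms(2) that by (simp add: is_hom_def)
  have mul: "mul' (f x) (f y) = f (mul x y)" if "x \<in> S" "y \<in> S" for x y
    using assms(2) that by (simp add: is_hom_def)
  show ?thesis
    using assms(1) unfolding idem_semiring_def assms(3)[symmetric] ball_simps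
    by (simp add: add mul)
qed

section \<open>Absorption and the dualities of the variety\<close>

locale VD_semiring =
  fixes S :: "'a set"
    and add :: "'a \<Rightarrow> 'a \<Rightarrow> 'a" (infixl "\<oplus>" 65)
    and mul :: "'a \<Rightarrow> 'a \<Rightarrow> 'a" (infixl "\<otimes>" 70)
  assumes in_VD: "in_VD S (\<oplus>) (\<otimes>)"
begin

lemma idem_semiring: "idem_semiring S (\<oplus>) (\<otimes>)"
  using in_VD by (simp add: in_VD_def)

lemma closed [simp]: "x \<in> S \<Longrightarrow> y \<in> S \<Longrightarrow> x \<oplus> y \<in> S" "x \<in> S \<Longrightarrow> y \<in> S \<Longrightarrow> x \<otimes> y \<in> S"
  and add_assoc: "x \<in> S \<Longrightarrow> y \<in> S \<Longrightarrow> z \<in> S \<Longrightarrow> x \<oplus> y \<oplus> z = x \<oplus> (y \<oplus> z)"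
  and mul_assoc: "x \<in> S \<Longrightarrow> y \<in> S \<Longrightarrow> z \<in> S \<Longrightarrow> x \<otimes> y \<otimes> z = x \<otimes> (y \<otimes> z)"
  and idem [simp]: "x \<in> S \<Longrightarrow> x \<oplus> x = x" "x \<in> S \<Longrightarrow> x \<otimes> x = x"
  and distrib_left: "x \<in> S \<Longrightarrow> y \<in> S \<Longrightarrow> z \<in> S \<Longrightarrow> x \<otimes> (y \<oplus> z) = x \<otimes> y \<oplus> x \<otimes> z"
  and distrib_right: "x \<in> S \<Longrightarrow> y \<in> S \<Longrightarrow> z \<in> S \<Longrightarrow> (x \<oplus> y) \<otimes> z = x \<otimes> z \<oplus> y \<otimes> z"
  using idem_semiring by (auto simp: idem_semiring_def)

lemma add_left_idem [simp]: "x \<in> S \<Longrightarrow> y \<in> S \<Longrightarrow> x \<oplus> (x \<oplus> y) = x \<oplus> y"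
  by (simp flip: add_assoc)

lemma mul_left_idem [simp]: "x \<in> S \<Longrightarrow> y \<in> S \<Longrightarrow> x \<otimes> (x \<otimes> y) = x \<otimes> y"
  by (simp flip: mul_assoc)

lemma add_pair_idem:
  assumes "x \<in> S" "y \<in> S"
  shows "x \<oplus> (y \<oplus> (x \<oplus> y)) = x \<oplus> y"
  using assms by (metis add_assoc idem(1) closed(1))

lemma mul_pair_idem:
  assumes "x \<in> S" "y \<in> S"
  shows "x \<otimes> (y \<otimes> (x \<otimes> y)) = x \<otimes> y"
  using assms by (metis mul_assoc idem(2) closed(2))

text \<open>With \<open>u = x y x\<close> the defining identity reads
  \<open>x = u \<oplus> x \<oplus> u\<close>. Adding a further \<open>u\<close> at either end
  changes nothing, by idempotence.\<close>

lemma mul_absorb: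
  assumes "x \<in> S" "y \<in> S"
  shows "x \<otimes> (y \<otimes> x) \<oplus> x = x" "x \<oplus> x \<otimes> (y \<otimes> x) = x"
proof -
  have x: "x = x \<otimes> (y \<otimes> x) \<oplus> (x \<oplus> x \<otimes> (y \<otimes> x))"
    using in_VD assms by (auto simp: in_VD_def add_assoc mul_assoc)
  then show "x \<otimes> (y \<otimes> x) \<oplus> x = x"
    using assms by (metis add_left_idem closed)
  show "x \<oplus> x \<otimes> (y \<otimes> x) = x"
    using x assms by (metis add_assoc idem(1) closed)
qed

text \<open>The product \<open>x y x\<close> is a palindrome, so the axioms survive reversing the
  multiplication. This is what transfers the results on R to L.\<close>

lemma mul_opposite: "VD_semiring S (\<oplus>) (\<lambda>x y. y \<otimes> x)"
  by unfold_locales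
    (auto simp: in_VD_def idem_semiring_def add_assoc mul_assoc distrib_left distrib_right mul_absorb)

text \<open>The defining identity is also symmetric in the order of summation. Reversing addition
  leaves R unchanged, so compatibility with sums is needed on one side only.\<close>

lemma add_opposite: "VD_semiring S (\<lambda>x y. y \<oplus> x) (\<otimes>)"
  by unfold_locales
    (auto simp: in_VD_def idem_semiring_def add_assoc mul_assoc distrib_left distrib_right mul_absorb)

section \<open>R and L are congruences\<close>

abbreviation R :: "('a \<times> 'a) set" where "R \<equiv> green_R S (\<otimes>)"
abbreviation L :: "('a \<times> 'a) set" where "L \<equiv> green_L S (\<otimes>)"
abbreviation D :: "('a \<times> 'a) set" where "D \<equiv> green_D S (\<otimes>)"

lemma R_iff: "(a, b) \<in> R \<longleftrightarrow> a \<in> S \<and> b \<in> S \<and> a \<otimes> b = b \<and> b \<otimes> a = a"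
  by (simp add: green_R_def)

lemma L_iff: "(a, b) \<in> L \<longleftrightarrow> a \<in> S \<and> b \<in> S \<and> a \<otimes> b = a \<and> b \<otimes> a = b"
  by (simp add: green_L_def)

lemma D_iff: "(a, b) \<in> D \<longleftrightarrow> a \<in> S \<and> b \<in> S \<and> a \<otimes> (b \<otimes> a) = a \<and> b \<otimes> (a \<otimes> b) = b"
  by (auto simp: green_D_def mul_assoc)

lemma R_sym: "(a, b) \<in> R \<Longrightarrow> (b, a) \<in> R"
  by (simp add: R_iff)

lemma R_trans:
  assumes "(a, b) \<in> R" "(b, c) \<in> R"
  shows "(a, c) \<in> R"
  using assms by (metis R_iff mul_assoc)

lemma equiv_R: "equiv S R"
proof (intro equivI symI transI refl_onI)
  show "R \<subseteq> S \<times> S" by (auto simp: R_iff)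
qed (auto simp: R_iff[of x x for x] intro: R_trans R_sym)

text \<open>Writing \<open>q = p q\<close> turns \<open>c p c q\<close> into
  \<open>c p c p q\<close>, where idempotence of \<open>c p\<close> removes one copy and leaves
  \<open>c q\<close>.\<close>

lemma R_mul_left:
  assumes "(a, b) \<in> R" "c \<in> S"
  shows "(c \<otimes> a, c \<otimes> b) \<in> R"
proof -
  have "c \<otimes> p \<otimes> (c \<otimes> q) = c \<otimes> q" if "(p, q) \<in> R" for p q
  proof -
    from that have pq: "p \<in> S" "q \<in> S" "p \<otimes> q = q" by (auto simp: R_iff)
    have "c \<otimes> p \<otimes> (c \<otimes> (p \<otimes> q)) = (c \<otimes> p) \<otimes> (c \<otimes> p) \<otimes> q"
      using pq(1,2) assms(2) by (simp only: mul_assoc closed)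
    also have "\<dots> = c \<otimes> q"
      using pq assms(2) by (simp add: mul_assoc)
    finally show ?thesis using pq(3) by simp
  qed
  from this[OF assms(1)] this[OF R_sym[OF assms(1)]] assms show ?thesis
    by (simp add: R_iff)
qed

text \<open>Absorption shows that \<open>b c \<oplus> a c b c\<close> equals \<open>b c\<close> as well as \<open>a c b c\<close>.\<close>

lemma R_mul_right:
  assumes "(a, b) \<in> R" "c \<in> S"
  shows "(a \<otimes> c, b \<otimes> c) \<in> R"
proof -
  have "p \<otimes> c \<otimes> (q \<otimes> c) = q \<otimes> c" if "(p, q) \<in> R" for p q
  proof -
    from that have pq: "p \<in> S" "q \<in> S" "p \<otimes> q = q" "q \<otimes> p = p" by (auto simp: R_iff)
    note S = pq(1,2) assms(2)
    have pq': "p \<otimes> (q \<otimes> c) = q \<otimes> c" "q \<otimes> (p \<otimes> c) = p \<otimes> c"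
      using pq S by (simp_all flip: mul_assoc)
    have idem': "q \<otimes> (c \<otimes> (q \<otimes> c)) = q \<otimes> c"
      using S by (simp add: mul_pair_idem)
    \<comment> \<open>The absorption \<open>p \<oplus> p c p = p\<close> is multiplied on the right
      by \<open>q c\<close>.\<close>
    have "(p \<oplus> p \<otimes> (c \<otimes> p)) \<otimes> (q \<otimes> c) = q \<otimes> c \<oplus> p \<otimes> (c \<otimes> (q \<otimes> c))"
      using S pq' by (simp add: distrib_right mul_assoc)
    then have 1: "q \<otimes> c \<oplus> p \<otimes> (c \<otimes> (q \<otimes> c)) = q \<otimes> c"
      using S pq' by (simp add: mul_absorb)
    have "c \<otimes> (p \<otimes> (c \<otimes> (q \<otimes> c))) = (c \<otimes> p) \<otimes> (c \<otimes> p) \<otimes> (q \<otimes> c)"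
      using S pq'(1) by (simp only: mul_assoc closed)
    also have "\<dots> = c \<otimes> (q \<otimes> c)"
      using S pq'(1) by (simp add: mul_assoc)
    finally have qcpcqc: "q \<otimes> (c \<otimes> (p \<otimes> (c \<otimes> (q \<otimes> c)))) = q \<otimes> c"
      using idem' by simp
    \<comment> \<open>Now \<open>q c q \<oplus> q = q\<close> is multiplied on the right by
      \<open>p c\<close> and then by \<open>q c\<close>; by \<open>qcpcqc\<close> the first summand
      shrinks to \<open>q c\<close>.\<close>
    have "(q \<otimes> (c \<otimes> q) \<oplus> q) \<otimes> (p \<otimes> c) = q \<otimes> (c \<otimes> (p \<otimes> c)) \<oplus> p \<otimes> c"
      using S pq' by (simp add: distrib_right mul_assoc)
    then have "q \<otimes> (c \<otimes> (p \<otimes> c)) \<oplus> p \<otimes> c = p \<otimes> c"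
      using S pq' by (simp add: mul_absorb)
    then have "(q \<otimes> (c \<otimes> (p \<otimes> c)) \<oplus> p \<otimes> c) \<otimes> (q \<otimes> c) = p \<otimes> c \<otimes> (q \<otimes> c)"
      by simp
    then have 2: "q \<otimes> c \<oplus> p \<otimes> (c \<otimes> (q \<otimes> c)) = p \<otimes> (c \<otimes> (q \<otimes> c))"
      using S qcpcqc by (simp add: distrib_right mul_assoc)
    show ?thesis using 1 2 S by (simp add: mul_assoc)
  qed
  from this[OF assms(1)] this[OF R_sym[OF assms(1)]] assms show ?thesis
    by (simp add: R_iff)
qed

text \<open>The point is that \<open>p v = q v\<close> for \<open>v = q \<oplus> c\<close>. Adding
  \<open>c v\<close> to both sides then gives \<open>(p \<oplus> c) v = v v = v\<close>.\<close>

lemma R_add_right: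
  assumes "(a, b) \<in> R" "c \<in> S"
  shows "(a \<oplus> c, b \<oplus> c) \<in> R"
proof -
  have "(p \<oplus> c) \<otimes> (q \<oplus> c) = q \<oplus> c" if "(p, q) \<in> R" for p q
  proof -
    from that have pq: "p \<in> S" "q \<in> S" "p \<otimes> q = q" "q \<otimes> p = p" by (auto simp: R_iff)
    define v where "v = q \<oplus> c"
    have S: "p \<in> S" "q \<in> S" "c \<in> S" "v \<in> S" using pq assms(2) by (auto simp: v_def)
    have "q \<otimes> v \<oplus> v = (q \<oplus> v) \<otimes> v"
      using S by (simp add: distrib_right)
    also have "\<dots> = v"
      using S by (simp add: v_def)
    finally have qvv: "q \<otimes> v \<oplus> v = v" .
    \<comment> \<open>Replacing \<open>q\<close> by \<open>p q\<close> gives the second summand the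
      shape \<open>p y p\<close>, which \<open>p\<close> absorbs. The left side is
      \<open>q v p\<close> expanded.\<close>
    have "p \<oplus> q \<otimes> (c \<otimes> p) = p \<oplus> p \<otimes> (q \<otimes> c \<otimes> p)"
      using S pq by (simp flip: mul_assoc)
    also have "\<dots> = p"
      using S by (simp add: mul_absorb)
    finally have qvp: "q \<otimes> (v \<otimes> p) = p"
      using S pq by (simp add: v_def distrib_left distrib_right)
    \<comment> \<open>The equation \<open>qvv\<close> brings in the summand \<open>q v\<close>. Then
      \<open>p = q v p\<close> turns \<open>p v\<close> into \<open>q v p v\<close>, and
      \<open>v\<close> absorbs \<open>v p v\<close> under the common factor
      \<open>q\<close>.\<close>
    have "p \<otimes> v = p \<otimes> (q \<otimes> v \<oplus> v)"
      using qvv by simp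
    also have "\<dots> = q \<otimes> v \<oplus> p \<otimes> v"
      using S pq by (simp add: distrib_left flip: mul_assoc)
    also have "\<dots> = q \<otimes> v \<oplus> q \<otimes> (v \<otimes> (p \<otimes> v))"
      using S by (metis qvp mul_assoc closed(2))
    also have "\<dots> = q \<otimes> v"
      using S by (simp add: mul_absorb flip: distrib_left)
    finally have "p \<otimes> v = q \<otimes> v" .
    then have "(p \<oplus> c) \<otimes> v = (q \<oplus> c) \<otimes> v"
      using S by (simp add: distrib_right)
    then show ?thesis using S by (simp add: v_def)
  qed
  from this[OF assms(1)] this[OF R_sym[OF assms(1)]] assms show ?thesis
    by (simp add: R_iff)
qed

lemma R_add_left:
  assumes "(a, b) \<in> R" "c \<in> S"
  shows "(c \<oplus> a, c \<oplus> b) \<in> R"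
  using VD_semiring.R_add_right[OF add_opposite assms] .

lemmas L_opposite = green_L_eq_green_R_opposite[of S "(\<otimes>)"]

lemma equiv_L: "equiv S L"
  using VD_semiring.equiv_R[OF mul_opposite] by (simp add: L_opposite)

lemma L_trans: "(a, b) \<in> L \<Longrightarrow> (b, c) \<in> L \<Longrightarrow> (a, c) \<in> L"
  using VD_semiring.R_trans[OF mul_opposite] by (simp add: L_opposite)

lemma L_mul_left: "(a, b) \<in> L \<Longrightarrow> c \<in> S \<Longrightarrow> (c \<otimes> a, c \<otimes> b) \<in> L"
  using VD_semiring.R_mul_right[OF mul_opposite] by (simp add: L_opposite)

lemma L_mul_right: "(a, b) \<in> L \<Longrightarrow> c \<in> S \<Longrightarrow> (a \<otimes> c, b \<otimes> c) \<in> L"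
  using VD_semiring.R_mul_left[OF mul_opposite] by (simp add: L_opposite)

lemma L_add_left: "(a, b) \<in> L \<Longrightarrow> c \<in> S \<Longrightarrow> (c \<oplus> a, c \<oplus> b) \<in> L"
  using VD_semiring.R_add_left[OF mul_opposite] by (simp add: L_opposite)

lemma L_add_right: "(a, b) \<in> L \<Longrightarrow> c \<in> S \<Longrightarrow> (a \<oplus> c, b \<oplus> c) \<in> L"
  using VD_semiring.R_add_right[OF mul_opposite] by (simp add: L_opposite)

section \<open>D as the composite of R and L\<close>

lemma R_L_eq: "(a, b) \<in> R \<Longrightarrow> (a, b) \<in> L \<Longrightarrow> a = b"
  by (metis R_iff L_iff)

text \<open>Together with \<open>R_L_imp_D\<close> this exhibits D as R followed by L, so that the
  congruence properties of R and L pass to D.\<close>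

lemma D_iff_R_L: "(a, b) \<in> D \<longleftrightarrow> (a, a \<otimes> b) \<in> R \<and> (a \<otimes> b, b) \<in> L"
  by (auto simp: D_iff R_iff L_iff mul_assoc)

text \<open>The middle element can only be \<open>a b\<close>: multiplying the first relation by
  \<open>b\<close> on the right and the second by \<open>a\<close> on the left shows that
  \<open>z\<close> is both R- and L-related to \<open>a b\<close>.\<close>

lemma R_L_imp_D:
  assumes "(a, z) \<in> R" "(z, b) \<in> L"
  shows "(a, b) \<in> D"
proof -
  have S: "a \<in> S" "b \<in> S" and z: "a \<otimes> z = z" "z \<otimes> b = z"
    using assms by (auto simp: R_iff L_iff)
  have "(z, a \<otimes> b) \<in> R"
    using R_sym[OF R_mul_right[OF assms(1) S(2)]] z by simp
  moreover have "(z, a \<otimes> b) \<in> L"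
    using L_mul_left[OF assms(2) S(1)] z by simp
  ultimately have "z = a \<otimes> b" by (rule R_L_eq)
  with assms show ?thesis by (simp add: D_iff_R_L)
qed

lemma D_sym: "(a, b) \<in> D \<Longrightarrow> (b, a) \<in> D"
  by (simp add: D_iff)

lemma D_trans:
  assumes "(a, b) \<in> D" "(b, c) \<in> D"
  shows "(a, c) \<in> D"
proof (rule R_L_imp_D)
  have S: "a \<in> S" "b \<in> S" "c \<in> S" using assms by (auto simp: D_iff)
  \<comment> \<open>The middle element is \<open>a b c\<close>, reached from \<open>a\<close>
    through \<open>a b\<close> under R and leading to \<open>c\<close> through \<open>b c\<close>
    under L.\<close>
  show "(a, a \<otimes> (b \<otimes> c)) \<in> R"
    using assms S by (meson D_iff_R_L R_mul_left R_trans)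
  show "(a \<otimes> (b \<otimes> c), c) \<in> L"
    using assms S by (metis D_iff_R_L L_mul_right L_trans mul_assoc)
qed

lemma equiv_D: "equiv S D"
proof (intro equivI symI transI refl_onI)
  show "D \<subseteq> S \<times> S" by (auto simp: D_iff)
qed (auto simp: D_iff[of x x for x] intro: D_trans D_sym)

lemma D_mul_left: "(a, b) \<in> D \<Longrightarrow> c \<in> S \<Longrightarrow> (c \<otimes> a, c \<otimes> b) \<in> D"
  by (meson D_iff_R_L R_L_imp_D R_mul_left L_mul_left)

lemma D_mul_right: "(a, b) \<in> D \<Longrightarrow> c \<in> S \<Longrightarrow> (a \<otimes> c, b \<otimes> c) \<in> D"
  by (meson D_iff_R_L R_L_imp_D R_mul_right L_mul_right)

lemma D_add_left: "(a, b) \<in> D \<Longrightarrow> c \<in> S \<Longrightarrow> (c \<oplus> a, c \<oplus> b) \<in> D"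
  by (meson D_iff_R_L R_L_imp_D R_add_left L_add_left)

lemma D_add_right: "(a, b) \<in> D \<Longrightarrow> c \<in> S \<Longrightarrow> (a \<oplus> c, b \<oplus> c) \<in> D"
  by (meson D_iff_R_L R_L_imp_D R_add_right L_add_right)

section \<open>The quotient by D is a distributive lattice\<close>

text \<open>In the quotient by D, this says that the sum is the least upper bound.\<close>

lemma add_least:
  assumes S: "a \<in> S" "c \<in> S" "t \<in> S"
    and t: "a \<otimes> (t \<otimes> a) = a" "c \<otimes> (t \<otimes> c) = c"
  shows "(a \<oplus> c) \<otimes> (t \<otimes> (a \<oplus> c)) = a \<oplus> c"
proof -
  define w where "w = (a \<oplus> c) \<otimes> (t \<otimes> (a \<oplus> c))"
  have wS: "w \<in> S" using S by (simp add: w_def)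
  have w: "w = a \<oplus> (c \<otimes> (t \<otimes> a) \<oplus> (a \<otimes> (t \<otimes> c) \<oplus> c))"
    using S t by (simp add: w_def distrib_left distrib_right add_assoc)
  \<comment> \<open>The expansion of \<open>w\<close> begins with \<open>a\<close> and ends with
    \<open>c\<close>; conversely \<open>a \<oplus> c\<close> absorbs \<open>w\<close> on both
    sides.\<close>
  have aw: "a \<oplus> w = w" and wc: "w \<oplus> c = w"
    using S by (simp_all add: w add_assoc)
  have uw: "a \<oplus> c \<oplus> w = a \<oplus> c" and wu: "w \<oplus> (a \<oplus> c) = a \<oplus> c"
    using S by (simp_all add: w_def mul_absorb)
  have "c \<oplus> (a \<oplus> (c \<oplus> (a \<oplus> w))) = c \<oplus> (a \<oplus> (c \<oplus> a)) \<oplus> w"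
    using S wS by (simp only: add_assoc closed)
  then have ca: "c \<oplus> (a \<oplus> (c \<oplus> (a \<oplus> w))) = c \<oplus> (a \<oplus> w)"
    using S wS by (simp add: add_pair_idem add_assoc)
  \<comment> \<open>Writing \<open>w\<close> as \<open>w \<oplus> c \<oplus> a \<oplus> w\<close>
    and doubling the inner \<open>c \<oplus> a\<close> puts \<open>a \<oplus> c\<close> between two
    copies of \<open>w\<close>, where it absorbs both.\<close>
  have "w = (w \<oplus> c) \<oplus> (a \<oplus> w)"
    using wS aw wc by simp
  also have "\<dots> = w \<oplus> (c \<oplus> (a \<oplus> (c \<oplus> (a \<oplus> w))))"
    using S wS ca by (simp add: add_assoc)
  also have "\<dots> = (w \<oplus> c) \<oplus> (a \<oplus> c) \<oplus> (a \<oplus> w)"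
    using S wS by (simp only: add_assoc closed)
  also have "\<dots> = a \<oplus> c"
    by (simp only: aw wc wu uw)
  finally show ?thesis by (simp add: w_def)
qed

text \<open>By absorption \<open>y \<oplus> x\<close> is an upper bound of \<open>x\<close> and
  \<open>y\<close> in the sense of \<open>add_least\<close>, so it lies above
  \<open>x \<oplus> y\<close>; exchanging \<open>x\<close> and \<open>y\<close> gives the
  converse.\<close>

lemma D_add_commute:
  assumes "a \<in> S" "c \<in> S"
  shows "(a \<oplus> c, c \<oplus> a) \<in> D"
proof -
  have "(x \<oplus> y) \<otimes> ((y \<oplus> x) \<otimes> (x \<oplus> y)) = x \<oplus> y" if "x \<in> S" "y \<in> S" for x y
    using that by (intro add_least) (simp_all add: distrib_left distrib_right mul_absorb)
  with assms show ?thesis by (simp add: D_iff)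
qed

lemma D_mul_commute:
  assumes "a \<in> S" "c \<in> S"
  shows "(a \<otimes> c, c \<otimes> a) \<in> D"
proof -
  have "x \<otimes> y \<otimes> (y \<otimes> x \<otimes> (x \<otimes> y)) = x \<otimes> y" if "x \<in> S" "y \<in> S" for x y
    using that by (simp add: mul_assoc mul_pair_idem)
  with assms show ?thesis by (simp add: D_iff)
qed

lemma D_absorb:
  assumes "a \<in> S" "c \<in> S"
  shows "(a \<oplus> a \<otimes> c, a) \<in> D"
proof -
  have "(a \<oplus> a \<otimes> c) \<otimes> a = a"
    using assms by (simp add: distrib_right mul_assoc mul_absorb)
  moreover have "a \<otimes> (a \<oplus> a \<otimes> c) = a \<oplus> a \<otimes> c"
    using assms by (simp add: distrib_left)
  ultimately show ?thesis
    using assms by (simp add: D_iff)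
qed

section \<open>The three quotients and the spined product\<close>

abbreviation (input) "qadd r \<equiv> quotient_op r (\<oplus>)"
abbreviation (input) "qmul r \<equiv> quotient_op r (\<otimes>)"

lemma R_class_op:
  assumes "x \<in> S" "y \<in> S"
  shows "qadd R (R `` {x}) (R `` {y}) = R `` {x \<oplus> y}"
    and "qmul R (R `` {x}) (R `` {y}) = R `` {x \<otimes> y}"
  using assms
  by (simp_all add: quotient_op_class[OF equiv_R] congruent2_classI[OF equiv_R]
      R_add_left R_add_right R_mul_left R_mul_right)

lemma L_class_op:
  assumes "x \<in> S" "y \<in> S"
  shows "qadd L (L `` {x}) (L `` {y}) = L `` {x \<oplus> y}"
    and "qmul L (L `` {x}) (L `` {y}) = L `` {x \<otimes> y}"
  using assms
  by (simp_all add: quotient_op_class[OF equiv_L] congruent2_classI[OF equiv_L]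
      L_add_left L_add_right L_mul_left L_mul_right)

lemma D_class_op:
  assumes "x \<in> S" "y \<in> S"
  shows "qadd D (D `` {x}) (D `` {y}) = D `` {x \<oplus> y}"
    and "qmul D (D `` {x}) (D `` {y}) = D `` {x \<otimes> y}"
  using assms
  by (simp_all add: quotient_op_class[OF equiv_D] congruent2_classI[OF equiv_D]
      D_add_left D_add_right D_mul_left D_mul_right)

lemma quotient_image: "S // r = (\<lambda>x. r `` {x}) ` S"
  by (auto simp: quotient_def)

text \<open>Multiplying \<open>x y \<oplus> x \<oplus> x y\<close> by \<open>x\<close> on the left
  changes nothing, and on the right it gives \<open>x y x \<oplus> x \<oplus> x y x = x\<close>. So
  this sum is R-related to \<open>x\<close>.\<close>

lemma in_VL_quotient: "in_VL (S // R) (qadd R) (qmul R)"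
proof -
  have "idem_semiring (S // R) (qadd R) (qmul R)"
    by (rule idem_semiring_hom_image[OF idem_semiring, of _ _ _ "\<lambda>x. R `` {x}"])
      (auto simp: is_hom_def R_class_op quotient_image)
  moreover have "R `` {x \<otimes> y \<oplus> x \<oplus> x \<otimes> y} = R `` {x}" if "x \<in> S" "y \<in> S" for x y
  proof (rule equiv_class_eq[OF equiv_R])
    show "(x \<otimes> y \<oplus> x \<oplus> x \<otimes> y, x) \<in> R"
      using that
      by (simp add: R_iff distrib_left distrib_right mul_assoc add_assoc mul_absorb)
  qed
  ultimately show ?thesis
    by (simp add: in_VL_def quotient_image R_class_op)
qed

lemma in_VR_quotient: "in_VR (S // L) (qadd L) (qmul L)"
proof -
  have "idem_semiring (S // L) (qadd L) (qmul L)"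
    by (rule idem_semiring_hom_image[OF idem_semiring, of _ _ _ "\<lambda>x. L `` {x}"])
      (auto simp: is_hom_def L_class_op quotient_image)
  moreover have "L `` {y \<otimes> x \<oplus> x \<oplus> y \<otimes> x} = L `` {x}" if "x \<in> S" "y \<in> S" for x y
  proof (rule equiv_class_eq[OF equiv_L])
    show "(y \<otimes> x \<oplus> x \<oplus> y \<otimes> x, x) \<in> L"
      using that
      by (simp add: L_iff distrib_left distrib_right mul_assoc add_assoc mul_absorb)
  qed
  ultimately show ?thesis
    by (simp add: in_VR_def quotient_image L_class_op)
qed

lemma distrib_lattice_quotient: "distrib_lattice_alg (S // D) (qadd D) (qmul D)"
proof -
  note eq = equiv_class_eq[OF equiv_D]
  \<comment> \<open>One absorption law suffices, because
    \<open>x (x \<oplus> y) = x \<oplus> x y\<close> by distributivity.\<close>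
  have "D `` {x \<oplus> y} = D `` {y \<oplus> x}" "D `` {x \<otimes> y} = D `` {y \<otimes> x}"
    "D `` {x \<oplus> x \<otimes> y} = D `` {x}" if "x \<in> S" "y \<in> S" for x y
    using that by (auto intro!: eq D_add_commute D_mul_commute D_absorb)
  then show ?thesis
    unfolding distrib_lattice_alg_def quotient_image ball_simps
    by (simp add: D_class_op add_assoc mul_assoc distrib_left)
qed

text \<open>Since R and L are contained in D, taking the image under D sends a class of either to
  the D-class around it. This map serves as both \<open>phi1\<close> and
  \<open>phi2\<close>.\<close>

lemma D_image_class:
  assumes "x \<in> S"
  shows "D `` (R `` {x}) = D `` {x}" "D `` (L `` {x}) = D `` {x}"
proof -
  have "R \<subseteq> D" "L \<subseteq> D"
    by (auto simp: R_iff L_iff D_iff)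
  moreover have "(x, x) \<in> R" "(x, x) \<in> L"
    using assms by (auto simp: R_iff L_iff)
  ultimately show "D `` (R `` {x}) = D `` {x}" "D `` (L `` {x}) = D `` {x}"
    by (blast intro: D_trans)+
qed

lemma is_iso_spined:
  "is_iso S (\<oplus>) (\<otimes>) (spined_carrier (S // R) (S // L) ((``) D) ((``) D))
     (prod_op (qadd R) (qadd L)) (prod_op (qmul R) (qmul L)) (\<lambda>x. (R `` {x}, L `` {x}))"
  unfolding is_iso_def
proof
  let ?f = "\<lambda>x. (R `` {x}, L `` {x})"
  let ?P = "spined_carrier (S // R) (S // L) ((``) D) ((``) D)"
  show "is_hom S (\<oplus>) (\<otimes>) ?P (prod_op (qadd R) (qadd L)) (prod_op (qmul R) (qmul L)) ?f"
    by (auto simp: is_hom_def prod_op_def spined_carrier_def R_class_op L_class_op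
        D_image_class quotient_image)
  have "inj_on ?f S"
    by (rule inj_onI) (auto simp: eq_equiv_class_iff[OF equiv_R] eq_equiv_class_iff[OF equiv_L]
        intro: R_L_eq)
  moreover have "?P \<subseteq> ?f ` S"
  proof
    fix p assume "p \<in> ?P"
    then obtain x y where xy: "x \<in> S" "y \<in> S" "p = (R `` {x}, L `` {y})"
      and "D `` {x} = D `` {y}"
      by (auto simp: spined_carrier_def quotient_image D_image_class)
    then have "(x, y) \<in> D"
      by (simp add: eq_equiv_class_iff[OF equiv_D])
    then have "R `` {x} = R `` {x \<otimes> y}" "L `` {y} = L `` {x \<otimes> y}"
      by (auto simp: D_iff_R_L dest: equiv_class_eq[OF equiv_R] equiv_class_eq[OF equiv_L])
    with xy show "p \<in> ?f ` S" by auto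
  qed
  moreover have "?f ` S \<subseteq> ?P"
    by (intro image_subsetI) (simp add: spined_carrier_def quotient_image D_image_class)
  ultimately show "bij_betw ?f S ?P"
    by (auto simp: bij_betw_def)
qed

lemma iso_spined_quotients:
  "iso_spined_LR S (\<oplus>) (\<otimes>) (S // R) (qadd R) (qmul R) (S // L) (qadd L) (qmul L)
     (S // D) (qadd D) (qmul D) ((``) D) ((``) D)"
proof -
  have "is_hom (S // R) (qadd R) (qmul R) (S // D) (qadd D) (qmul D) ((``) D)"
    by (auto simp: is_hom_def quotient_image R_class_op D_class_op D_image_class)
  moreover have "is_hom (S // L) (qadd L) (qmul L) (S // D) (qadd D) (qmul D) ((``) D)"
    by (auto simp: is_hom_def quotient_image L_class_op D_class_op D_image_class)
  moreover have "(``) D ` (S // R) = S // D" "(``) D ` (S // L) = S // D"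
    by (auto simp: quotient_image image_image D_image_class)
  ultimately show ?thesis
    using in_VL_quotient in_VR_quotient distrib_lattice_quotient is_iso_spined
    unfolding iso_spined_LR_def isomorphic_def by blast
qed

end

section \<open>From a spined product back to the identity\<close>

text \<open>Each one-sided identity gives the two-sided one on replacing \<open>y\<close> by \<open>y x\<close> or \<open>x y\<close>.\<close>

lemma in_VL_imp_in_VD:
  assumes "in_VL S add mul"
  shows "in_VD S add mul"
proof -
  from assms have S: "idem_semiring S add mul" by (simp add: in_VL_def)
  have "x = add (add (mul (mul x y) x) x) (mul (mul x y) x)" if "x \<in> S" "y \<in> S" for x y
  proof -
    have "mul y x \<in> S" "mul (mul x y) x = mul x (mul y x)"
      using S that by (auto simp: idem_semiring_def)
    with assms that show ?thesis by (auto simp: in_VL_def)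
  qed
  with S show ?thesis by (simp add: in_VD_def)
qed

lemma in_VR_imp_in_VD:
  assumes "in_VR S add mul"
  shows "in_VD S add mul"
proof -
  from assms have S: "idem_semiring S add mul" by (simp add: in_VR_def)
  have "x = add (add (mul (mul x y) x) x) (mul (mul x y) x)" if "x \<in> S" "y \<in> S" for x y
  proof -
    have "mul x y \<in> S"
      using S that by (auto simp: idem_semiring_def)
    with assms that show ?thesis by (auto simp: in_VR_def)
  qed
  with S show ?thesis by (simp add: in_VD_def)
qed

lemma in_VD_identity:
  assumes "in_VD S add mul" "x \<in> S" "y \<in> S"
  shows "add (add (mul (mul x y) x) x) (mul (mul x y) x) = x"
  using assms(1)[unfolded in_VD_def, THEN conjunct2, rule_format, OF assms(2,3)] by (rule sym)

text \<open>Both factors satisfy the two-sided identity, hence so do pairs componentwise, and the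
  injective homomorphism \<open>f\<close> reflects it back to \<open>S\<close>.\<close>

lemma iso_spined_imp_in_VD:
  assumes "idem_semiring S add mul"
    and spined: "iso_spined_LR S add mul S1 add1 mul1 S2 add2 mul2 D join meet phi1 phi2"
  shows "in_VD S add mul"
proof -
  let ?P = "spined_carrier S1 S2 phi1 phi2"
  obtain f where iso: "is_iso S add mul ?P (prod_op add1 add2) (prod_op mul1 mul2) f"
    using spined by (auto simp: iso_spined_LR_def isomorphic_def)
  then have f: "inj_on f S" "\<And>x. x \<in> S \<Longrightarrow> f x \<in> ?P"
    and hom: "\<And>x y. x \<in> S \<Longrightarrow> y \<in> S \<Longrightarrow> f (add x y) = prod_op add1 add2 (f x) (f y)"
      "\<And>x y. x \<in> S \<Longrightarrow> y \<in> S \<Longrightarrow> f (mul x y) = prod_op mul1 mul2 (f x) (f y)"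
    by (simp_all add: is_iso_def is_hom_def bij_betw_def)
  have VD: "in_VD S1 add1 mul1" "in_VD S2 add2 mul2"
    using spined by (simp_all add: iso_spined_LR_def in_VL_imp_in_VD in_VR_imp_in_VD)
  have closed: "add x y \<in> S" "mul x y \<in> S" if "x \<in> S" "y \<in> S" for x y
    using assms(1) that by (auto simp: idem_semiring_def)
  have "x = add (add (mul (mul x y) x) x) (mul (mul x y) x)" if "x \<in> S" "y \<in> S" for x y
  proof (rule inj_onD[OF f(1)])
    have "fst (f x) \<in> S1" "snd (f x) \<in> S2" "fst (f y) \<in> S1" "snd (f y) \<in> S2"
      using f(2)[OF that(1)] f(2)[OF that(2)] by (auto simp: spined_carrier_def)
    note VD_f = in_VD_identity[OF VD(1) this(1,3)] in_VD_identity[OF VD(2) this(2,4)]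
    from that show "f x = f (add (add (mul (mul x y) x) x) (mul (mul x y) x))"
      by (simp add: closed hom prod_op_def VD_f)
  qed (use that closed in auto)
  with assms(1) show ?thesis by (simp add: in_VD_def)
qed

text \<open>The existential half has to fix the types of its carriers: quotients of \<open>S\<close>
  consist of subsets of \<open>S\<close>, hence \<open>'a set set\<close>. The converse half leaves
  the types of the factors and of the lattice arbitrary.\<close>

theorem theorem4p9:
  fixes S :: "'a set" and add mul :: "'a \<Rightarrow> 'a \<Rightarrow> 'a"
  assumes "idem_semiring S add mul"
  shows "(in_VD S add mul \<longrightarrow>
            (\<exists>(S1 :: 'a set set) add1 mul1 (S2 :: 'a set set) add2 mul2
               (D :: 'a set set) join meet phi1 phi2.
               iso_spined_LR S add mul S1 add1 mul1 S2 add2 mul2 D join meet phi1 phi2))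
       \<and> (\<forall>(S1 :: 'b set) add1 mul1 (S2 :: 'c set) add2 mul2
               (D :: 'd set) join meet phi1 phi2.
             iso_spined_LR S add mul S1 add1 mul1 S2 add2 mul2 D join meet phi1 phi2
             \<longrightarrow> in_VD S add mul)"
proof (intro conjI impI allI)
  assume "in_VD S add mul"
  then interpret VD_semiring S add mul by unfold_locales
  show "\<exists>(S1 :: 'a set set) add1 mul1 (S2 :: 'a set set) add2 mul2
          (D :: 'a set set) join meet phi1 phi2.
          iso_spined_LR S add mul S1 add1 mul1 S2 add2 mul2 D join meet phi1 phi2"
    using iso_spined_quotients by blast
qed (rule iso_spined_imp_in_VD[OF assms])

end
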